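(* The function $G:S(-\pi/3,\pi/3)\to\mathbb C$ is a conformal mapping, i.e. it is holomorphic and one-to-one on $S(-\pi/3,\pi/3)$.
   Context: Let $\mathcal A=\mathbb C\setminus(-\infty,0]$ and let $\operatorname{Log} z=\ln|z|+i\operatorname{Arg} z$ be the principal logarithm on $\mathcal A$, with $-\pi<\operatorname{Arg} z<\pi$. The function $G$ is defined by $$ G(z)=\left(1-\frac{\operatorname{Log} z}{\operatorname{Log}(1+z)}\right)z\operatorname{Log} z,\quad z\in\mathcal A. $$ For real $a<b$, $S(a,b)=\{z\ne 0 : a<\operatorname{Arg} z<b\}$ denotes the open sector. *)

theory Defs
  imports "HOL-Complex_Analysis.Complex_Analysis"
begin

definition open_sector :: "real \<Rightarrow> real \<Rightarrow> complex set" where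
  "open_sector a b = {z. z \<noteq> 0 \<and> a < Arg z \<and> Arg z < b}"

(* Meant on the cut plane UNIV - \<real>\<^sub>\<le>\<^sub>0.  There Ln is the principal logarithm, and 1 + z
   also lies in the cut plane and differs from 1, so the denominator does not vanish.
   The values off the cut plane are those of the totalized Ln and division. *)
definition G :: "complex \<Rightarrow> complex" where
  "G z = (1 - Ln z / Ln (1 + z)) * z * Ln z"

end

(*
  With L = Ln z, M = Ln (1 + z) and D = Ln (1 + 1/z) = M - L one has G = L Q, where Q = z D / M.
  In the coordinate log z the sector is a convex strip and the derivative of G becomes
  z G'(z) = Q K.  On the closed upper half of the sector the argument of Q K lies strictly between
  -5 pi/6 and pi/6, so rotating by pi/3 makes the real part of the derivative positive and the
  mean value theorem gives injectivity there.  Moreover G is real on the real axis and maps the open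
  upper half of the sector to the upper half-plane; injectivity on the whole sector follows from
  G (cnj z) = cnj (G z).

  The argument bounds are needed for |z| >= 1 only, because Q (1/z) = 1 / Q z and
  K (1/z) = 2 - K z.  For |z| >= 1 they come from the integrals of 1/(z + t) and (1 - t)/(z + t)
  over 0 <= t <= 1, which represent D and P = (1 + z) D - 1.
*)
theory Submission
  imports Defs
begin

section \<open>Principal logarithms on the right half-plane and integral representations\<close>

lemma Re_pos_not_nonpos_Reals: "0 < Re z \<Longrightarrow> z \<notin> \<real>\<^sub>\<le>\<^sub>0"
  by (auto simp: complex_nonpos_Reals_iff)

text \<open>Both sides have the same exponential. The imaginary parts of \<open>Ln (1 + z)\<close>
  and \<open>Ln z\<close> are below pi/2 in modulus, so their difference stays in the principal
  strip.\<close>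

lemma Ln_one_plus_inverse:
  assumes "0 < Re z"
  shows "Ln (1 + 1 / z) = Ln (1 + z) - Ln z"
proof -
  have z: "z \<noteq> 0" "1 + z \<noteq> 0" "0 < Re (1 + z)"
    using assms by (auto simp: complex_eq_iff)
  have "exp (Ln (1 + z) - Ln z) = 1 + 1 / z"
    using z by (simp add: exp_diff field_simps)
  moreover have "\<bar>Im (Ln (1 + z))\<bar> < pi / 2" "\<bar>Im (Ln z)\<bar> < pi / 2"
    using assms z by (blast intro: Re_Ln_pos_lt_imp)+
  ultimately show ?thesis
    by (subst Ln_exp[symmetric, of "Ln (1 + z) - Ln z"]) auto
qed

text \<open>Turns pointwise bounds into half-plane constraints on an integral; the factor
  \<open>k\<close> selects the half-plane, e.g. \<open>k = \<i>\<close> bounds the negative of the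
  imaginary part.\<close>

lemma has_integral_Re_ge:
  fixes f :: "real \<Rightarrow> complex"
  assumes "(f has_integral I) S" "(g has_integral J) S"
    and "\<And>t. t \<in> S \<Longrightarrow> g t \<le> Re (k * f t)"
  shows "J \<le> Re (k * I)"
proof -
  have "((\<lambda>t. Re (k * f t)) has_integral Re (k * I)) S"
    using has_integral_linear[OF has_integral_mult_right[OF assms(1)] bounded_linear_Re]
    by (simp add: o_def)
  with assms(2,3) show ?thesis
    by (meson has_integral_le)
qed

lemma has_integral_norm_le:
  fixes f :: "real \<Rightarrow> complex"
  assumes "(f has_integral I) S" "(g has_integral J) S"
    and "\<And>t. t \<in> S \<Longrightarrow> norm (f t) \<le> g t"
  shows "norm I \<le> J"
  using integral_norm_bound_integral[of f S g] assms
  by (metis has_integral_integrable_integral)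

lemma has_integral_affine_unit: "((\<lambda>t. a + b * t) has_integral (a + b / 2)) {0..1::real}"
proof -
  have "((\<lambda>t. a * t + b * t\<^sup>2 / 2) has_vector_derivative (a + b * t)) (at t within {0..1})" for t
    unfolding has_real_derivative_iff_has_vector_derivative[symmetric]
    by (auto intro!: derivative_eq_intros)
  from fundamental_theorem_of_calculus[OF zero_le_one this] show ?thesis
    by simp
qed

text \<open>The antiderivatives are \<open>Ln (z + t)\<close> and, since (1 - t)/(z + t) = (1 +
  z)/(z + t) - 1, \<open>(1 + z) * Ln (z + t) - t\<close>.\<close>

lemma
  assumes "0 < Re z"
  shows has_integral_inverse_shift:
      "((\<lambda>t. 1 / (z + of_real t)) has_integral Ln (1 + 1 / z)) {0..1}"
    and has_integral_weighted_inverse_shift: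
      "((\<lambda>t. of_real (1 - t) / (z + of_real t)) has_integral (1 + z) * Ln (1 + 1 / z) - 1) {0..1}"
proof -
  have pos: "z + of_real t \<notin> \<real>\<^sub>\<le>\<^sub>0" "z + of_real t \<noteq> 0" if "t \<in> {0..1}" for t
    using assms that Re_pos_not_nonpos_Reals[of "z + of_real t"]
    by (auto simp: complex_eq_iff)
  have "((\<lambda>t. Ln (z + of_real t)) has_vector_derivative 1 / (z + of_real t)) (at t within {0..1})"
    if "t \<in> {0..1}" for t
    using pos[OF that]
    by (intro has_vector_derivative_real_field) (auto intro!: derivative_eq_intros simp: inverse_eq_divide)
  from fundamental_theorem_of_calculus[OF zero_le_one this]
  show "((\<lambda>t. 1 / (z + of_real t)) has_integral Ln (1 + 1 / z)) {0..1}"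
    by (simp add: Ln_one_plus_inverse[OF assms] add.commute)
  have "((\<lambda>t. (1 + z) * Ln (z + of_real t) - of_real t) has_vector_derivative
      of_real (1 - t) / (z + of_real t)) (at t within {0..1})" if "t \<in> {0..1}" for t
    using pos[OF that]
    by (intro has_vector_derivative_real_field[where f = "\<lambda>w. (1 + z) * Ln (z + w) - w"])
       (auto intro!: derivative_eq_intros simp: field_simps)
  from fundamental_theorem_of_calculus[OF zero_le_one this]
  show "((\<lambda>t. of_real (1 - t) / (z + of_real t)) has_integral (1 + z) * Ln (1 + 1 / z) - 1) {0..1}"
    by (simp add: Ln_one_plus_inverse[OF assms] add.commute algebra_simps)
qed

section \<open>The factors of the derivative and their inversion symmetry\<close>

text \<open>Written with \<open>Ln (1 + 1 / z)\<close> instead of a difference of logarithms, so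
  that z -> 1/z visibly exchanges numerator and denominator.\<close>

definition Q :: "complex \<Rightarrow> complex" where
  "Q z = z * Ln (1 + 1 / z) / Ln (1 + z)"

text \<open>The factor multiplying \<open>Ln z\<close> is z Q'/Q, the derivative of log Q with
  respect to log z.\<close>

definition K :: "complex \<Rightarrow> complex" where
  "K z = 1 + Ln z * (1 - 1 / ((1 + z) * Ln (1 + 1 / z)) - z / ((1 + z) * Ln (1 + z)))"

definition P :: "complex \<Rightarrow> complex" where
  "P z = (1 + z) * Ln (1 + 1 / z) - 1"

lemma Ln_one_plus_nonzero:
  assumes "0 < Re z"
  shows "Ln (1 + z) \<noteq> 0" "Ln (1 + 1 / z) \<noteq> 0"
proof -
  have z: "z \<noteq> 0" "1 + z \<noteq> 0" using assms by (auto simp: complex_eq_iff)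
  then have "1 + z \<noteq> 1" by simp
  with z show "Ln (1 + z) \<noteq> 0" by (metis exp_Ln exp_zero)
  have "1 + 1 / z \<noteq> 0" "1 + 1 / z \<noteq> 1"
    using z by (auto simp: field_simps)
  then show "Ln (1 + 1 / z) \<noteq> 0" by (metis exp_Ln exp_zero)
qed

lemma G_eq_Ln_Q:
  assumes "0 < Re z"
  shows "G z = Ln z * Q z"
  using Ln_one_plus_nonzero[OF assms]
  by (simp add: G_def Q_def Ln_one_plus_inverse[OF assms] field_simps)

lemma Q_inverse: "0 < Re z \<Longrightarrow> Q (1 / z) = 1 / Q z"
  by (auto simp: Q_def)

text \<open>Inversion negates \<open>Ln z\<close> and swaps the two quotients in the bracket, so
  \<open>K z - 1\<close> only changes sign.\<close>

lemma K_inverse: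
  assumes "0 < Re z"
  shows "K (1 / z) = 2 - K z"
proof -
  have z: "z \<noteq> 0" "1 + z \<noteq> 0" using assms by (auto simp: complex_eq_iff)
  have "Ln (1 / z) = - Ln z"
    using Ln_inverse[OF Re_pos_not_nonpos_Reals[OF assms]] by (simp add: inverse_eq_divide)
  moreover have "1 / ((1 + 1 / z) * X) = z / ((1 + z) * X)"
    "1 / z / ((1 + 1 / z) * X) = 1 / ((1 + z) * X)" for X
    using z by (simp_all add: divide_simps add.commute mult.commute)
  ultimately show ?thesis
    by (simp add: K_def algebra_simps)
qed

lemma G_has_field_derivative:
  assumes "0 < Re z"
  shows "(G has_field_derivative Q z * K z / z) (at z)"
proof -
  have z: "z \<noteq> 0" "1 + z \<noteq> 0" "z \<notin> \<real>\<^sub>\<le>\<^sub>0" "1 + z \<notin> \<real>\<^sub>\<le>\<^sub>0"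
    using assms by (auto simp: complex_eq_iff complex_nonpos_Reals_iff)
  note nz = Ln_one_plus_nonzero[OF assms]
  define L M where "L = Ln z" and "M = Ln (1 + z)"
  have nz': "M \<noteq> 0" "M - L \<noteq> 0"
    using nz by (simp_all add: L_def M_def Ln_one_plus_inverse[OF assms])
  have "(G has_field_derivative ((1 - L / M) * z) * (1 / z) +
      ((1 - L / M) - ((1 / z) * M - L * (1 / (1 + z))) / (M * M) * z) * L) (at z)"
    unfolding G_def L_def M_def using z nz
    by (auto intro!: derivative_eq_intros simp: inverse_eq_divide algebra_simps add_divide_distrib diff_divide_distrib)
  also have "((1 - L / M) * z) * (1 / z) +
      ((1 - L / M) - ((1 / z) * M - L * (1 / (1 + z))) / (M * M) * z) * L = Q z * K z / z"
    unfolding Q_def K_def Ln_one_plus_inverse[OF assms] L_def[symmetric] M_def[symmetric]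
    using nz' z by (simp add: divide_simps) (simp add: algebra_simps)
  finally show ?thesis .
qed

text \<open>Separates terms that can be estimated by size: 1 - 1/((1 + z) D) is P/(1 + P), and the
  remaining terms combine to (1 + Q)/(1 + z). This form serves to bound
  \<open>2 - K z\<close>.\<close>

lemma K_eq:
  assumes "0 < Re z" "P z \<noteq> -1"
  shows "K z = (1 + Q z) / (1 + z) + Ln z * (P z / (1 + P z))"
proof -
  have z: "z \<noteq> 0" "1 + z \<noteq> 0" using assms by (auto simp: complex_eq_iff)
  define L M where "L = Ln z" and "M = Ln (1 + z)"
  have nz': "M \<noteq> 0" "M - L \<noteq> 0"
    using Ln_one_plus_nonzero[OF assms(1)] by (simp_all add: L_def M_def Ln_one_plus_inverse[OF assms(1)])
  show ?thesis
    unfolding Q_def K_def P_def Ln_one_plus_inverse[OF assms(1)] L_def[symmetric] M_def[symmetric]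
    using nz' z by (simp add: divide_simps) (simp add: algebra_simps)
qed

text \<open>The explicit factor \<open>Ln z\<close> of \<open>K z\<close> is eliminated. Each
  summand is a product over \<open>1 + z\<close> whose argument can be bounded factor by
  factor.\<close>

lemma Q_times_K:
  assumes "0 < Re z"
  shows "Q z * K z = Q z * (Q z + 1 - P z) / (1 + z) + P z * z / (1 + z)"
proof -
  have z: "z \<noteq> 0" "1 + z \<noteq> 0" using assms by (auto simp: complex_eq_iff)
  define L M where "L = Ln z" and "M = Ln (1 + z)"
  have nz': "M \<noteq> 0" "M - L \<noteq> 0"
    using Ln_one_plus_nonzero[OF assms(1)] by (simp_all add: L_def M_def Ln_one_plus_inverse[OF assms(1)])
  show ?thesis
    unfolding Q_def K_def P_def Ln_one_plus_inverse[OF assms(1)] L_def[symmetric] M_def[symmetric]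
    using nz' z by (simp add: divide_simps) (simp add: algebra_simps)
qed

section \<open>Arguments as linear conditions on real and imaginary parts\<close>

text \<open>On the right half-plane \<open>Arg x\<close> is the arctangent of
  \<open>Im x / Re x\<close>. Multiplying out the tangent leaves linear inequalities, which integral
  bounds can supply.\<close>

lemma
  assumes "0 < Re x" "\<bar>a\<bar> < pi / 2"
  shows Arg_le_if: "Im x * cos a \<le> Re x * sin a \<Longrightarrow> Arg x \<le> a"
    and Arg_ge_if: "Re x * sin a \<le> Im x * cos a \<Longrightarrow> a \<le> Arg x"
proof -
  have "0 < cos a" using assms(2) by (intro cos_gt_zero_pi) auto
  moreover have "arctan (tan a) = a"
    using assms(2) by (intro arctan_tan) auto
  moreover have "Arg x = arctan (Im x / Re x)"
    using assms(1) by (rule arg_conv_arctan)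
  ultimately show "Im x * cos a \<le> Re x * sin a \<Longrightarrow> Arg x \<le> a"
    "Re x * sin a \<le> Im x * cos a \<Longrightarrow> a \<le> Arg x"
    using assms(1) arctan_le_iff[of "Im x / Re x" "tan a"] arctan_le_iff[of "tan a" "Im x / Re x"]
    by (simp_all add: tan_def pos_divide_le_eq pos_le_divide_eq mult_ac)
qed

lemma Arg_ge_minus_pi_quarter:
  assumes "0 < Re x" "0 \<le> Re x + Im x"
  shows "- (pi / 4) \<le> Arg x"
proof (rule Arg_ge_if[OF assms(1)])
  show "Re x * sin (- (pi / 4)) \<le> Im x * cos (- (pi / 4))"
    using mult_right_mono[of "- Re x" "Im x" "sqrt 2 / 2"] assms(2) by (simp add: cos_45 sin_45)
qed simp

lemma Re_cis_mult: "Re (cis a * x) = norm x * cos (a + Arg x)"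
proof -
  have "Re (cis a * x) = Re (cis a * rcis (norm x) (Arg x))"
    by (simp add: rcis_cmod_Arg)
  then show ?thesis
    by (simp add: rcis_def cos_add algebra_simps)
qed

text \<open>Only the cosine of the sum of arguments enters, so the sum need not be reduced to the
  principal range.\<close>

lemma Re_cis_mult_divide:
  assumes "w \<noteq> 0"
  shows "Re (cis a * (x * y / w)) = norm x * norm y / norm w * cos (a + Arg x + Arg y - Arg w)"
proof -
  have "x * y / w = rcis (norm x) (Arg x) * rcis (norm y) (Arg y) / rcis (norm w) (Arg w)"
    by (simp add: rcis_cmod_Arg)
  also have "cis a * \<dots> = rcis (norm x * norm y / norm w) (a + Arg x + Arg y - Arg w)"
    by (simp add: rcis_mult rcis_divide rcis_def cis_mult[symmetric] cis_divide[symmetric] field_simps)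
  finally show ?thesis by simp
qed

section \<open>Estimates for real and complex logarithms\<close>

text \<open>Termwise comparison of the power series gives |e^w - 1| <= e^|w| - 1; take w =
  \<open>Ln (1 + z)\<close>.\<close>

lemma ln_one_plus_norm_le:
  assumes "1 + z \<noteq> 0"
  shows "ln (1 + norm z) \<le> norm (Ln (1 + z))"
proof -
  have "norm z = norm (exp (Ln (1 + z)) - 1)"
    using assms by simp
  also have "\<dots> \<le> exp (norm (Ln (1 + z))) - 1"
  proof -
    have "norm (exp w - 1) \<le> exp (norm w) - 1" for w :: complex
    proof -
      have 1: "(\<lambda>n. w ^ Suc n /\<^sub>R fact (Suc n)) sums (exp w - 1)"
        using exp_converges[of w] sums_Suc_iff[of "\<lambda>n. w ^ n /\<^sub>R fact n" "exp w - 1"] by simp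
      have 2: "(\<lambda>n. norm w ^ Suc n /\<^sub>R fact (Suc n)) sums (exp (norm w) - 1)"
        using exp_converges[of "norm w"] sums_Suc_iff[of "\<lambda>n. norm w ^ n /\<^sub>R fact n" "exp (norm w) - 1"] by simp
      have "norm (suminf (\<lambda>n. w ^ Suc n /\<^sub>R fact (Suc n))) \<le> suminf (\<lambda>n. norm w ^ Suc n /\<^sub>R fact (Suc n))"
        using 2 by (intro norm_suminf_le) (auto simp: norm_mult norm_power sums_iff divide_simps)
      with 1 2 show ?thesis by (simp add: sums_iff)
    qed
    then show ?thesis .
  qed
  finally have "ln (1 + norm z) \<le> ln (exp (norm (Ln (1 + z))))"
    by (subst ln_le_cancel_iff) (auto intro: add_pos_nonneg)
  then show ?thesis by simp
qed

text \<open>This is the extreme case t = pi/3 of the next lemma: there \<open>Ln (1 + cis t)\<close>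
  has real part (ln 3)/2 and imaginary part pi/6.\<close>

lemma pi_third_le_ln_3: "pi / 3 \<le> ln 3"
  using ln_approx_bounds[of 3 2] pi_approx by (simp add: eval_nat_numeral)

text \<open>Since 1 + e^(it) = 2 cos(t/2) e^(it/2), the chain t/2 <= pi/6 <= ln (sqrt 3) <= ln (2
  cos(t/2)) suffices.\<close>

lemma Im_Ln_one_plus_cis_le:
  assumes "0 \<le> t" "t \<le> pi / 3"
  shows "Im (Ln (1 + cis t)) \<le> Re (Ln (1 + cis t))"
proof -
  have "cos (pi / 6) \<le> cos (t / 2)"
    using assms by (intro cos_monotone_0_pi_le) auto
  then have c: "sqrt 3 \<le> 2 * cos (t / 2)" by (simp add: cos_30)
  then have pos: "0 < 2 * cos (t / 2)"
    by (smt (verit) real_sqrt_gt_zero)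
  have "1 + cis t = of_real (2 * cos (t / 2)) * cis (t / 2)"
    using cos_double_cos[of "t / 2"] sin_double[of "t / 2"]
    by (simp add: complex_eq_iff power2_eq_square)
  also have "\<dots> = exp (of_real (ln (2 * cos (t / 2))) + \<i> * of_real (t / 2))"
    using pos by (simp add: exp_add cis_conv_exp exp_of_real del: of_real_mult)
  finally have e: "1 + cis t = exp (of_real (ln (2 * cos (t / 2))) + \<i> * of_real (t / 2))" .
  have "Ln (1 + cis t) = of_real (ln (2 * cos (t / 2))) + \<i> * of_real (t / 2)"
  proof -
    have "- pi < t / 2" "t / 2 \<le> pi" using assms pi_gt_zero by linarith+
    then show ?thesis unfolding e by (intro Ln_exp) simp_all
  qed
  moreover have "pi / 6 \<le> ln (sqrt 3)"
    using pi_third_le_ln_3 by (simp add: ln_sqrt)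
  moreover have "ln (sqrt 3) \<le> ln (2 * cos (t / 2))"
    using c pos by simp
  ultimately show ?thesis
    using assms by simp
qed

text \<open>The unit circle is the previous lemma, and the difference of real and imaginary part
  does not decrease outward along the ray.\<close>

lemma Im_Ln_one_plus_rcis_le:
  assumes "0 \<le> t" "t \<le> pi / 3" "1 \<le> r"
  shows "Im (Ln (1 + rcis r t)) \<le> Re (Ln (1 + rcis r t))"
proof -
  \<comment> \<open>The factor \<open>1 + \<i>\<close> makes this the real part minus the imaginary
    part of the logarithm.\<close>
  define \<phi> where "\<phi> s = Re ((1 + \<i>) * Ln (1 + of_real s * cis t))" for s
  have c: "0 < cos t" "sin t \<le> 1"
  proof -
    have "t < pi / 2" "- (pi / 2) < t" using assms pi_gt_zero by linarith+
    then show "0 < cos t" by (intro cos_gt_zero_pi)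
  qed simp
  have d: "\<exists>y. (\<phi> has_real_derivative y) (at s) \<and> 0 \<le> y" if s: "1 \<le> s" for s
  proof -
    have pos: "0 < Re (1 + of_real s * cis t)" using c s by (simp add: add_pos_nonneg)
    have "((\<lambda>s. (1 + \<i>) * Ln (1 + s * cis t)) has_field_derivative
        (1 + \<i>) * (cis t / (1 + of_real s * cis t))) (at (of_real s))"
      using Re_pos_not_nonpos_Reals[OF pos]
      by (auto intro!: derivative_eq_intros simp: divide_inverse algebra_simps)
    then have "((\<lambda>s. (1 + \<i>) * Ln (1 + of_real s * cis t)) has_vector_derivative
        (1 + \<i>) * (cis t / (1 + of_real s * cis t))) (at s)"
      by (rule has_vector_derivative_real_field)
    then have "(\<phi> has_vector_derivative Re ((1 + \<i>) * (cis t / (1 + of_real s * cis t)))) (at s)"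
      unfolding \<phi>_def
      using bounded_linear.has_vector_derivative[OF bounded_linear_Re] by blast
    moreover have "0 \<le> Re ((1 + \<i>) * (cis t / (1 + of_real s * cis t)))"
    proof -
      have "(1 + s * cos t)\<^sup>2 + (s * sin t)\<^sup>2 > 0"
        using pos by (simp add: add_pos_nonneg)
      \<comment> \<open>This is the numerator of the derivative; it is nonnegative because sin t <=
        1 <= s and cos t > 0.\<close>
      moreover have "0 \<le> cos t + s * ((cos t)\<^sup>2 + (sin t)\<^sup>2) - sin t"
        unfolding sin_cos_squared_add2 using c s by linarith
      moreover have "Re ((1 + \<i>) * cis t / (1 + of_real s * cis t)) =
          ((cos t - sin t) * (1 + s * cos t) + (cos t + sin t) * (s * sin t)) /
          ((1 + s * cos t)\<^sup>2 + (s * sin t)\<^sup>2)"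
        unfolding Re_divide by (simp add: add.commute)
      moreover have "(cos t - sin t) * (1 + s * cos t) + (cos t + sin t) * (s * sin t) =
          cos t + s * ((cos t)\<^sup>2 + (sin t)\<^sup>2) - sin t"
        by algebra
      ultimately show ?thesis by (simp only: times_divide_eq_right divide_nonneg_pos)
    qed
    ultimately show ?thesis
      by (auto simp: has_real_derivative_iff_has_vector_derivative)
  qed
  have "\<phi> 1 \<le> \<phi> r"
    using d by (intro DERIV_nonneg_imp_nondecreasing[OF assms(3)]) auto
  then show ?thesis
    using Im_Ln_one_plus_cis_le[OF assms(1,2)] by (simp add: \<phi>_def rcis_def)
qed

text \<open>The difference vanishes at 0 and has derivative y^2 / ((1 + y) (2 + y)^2).\<close>

lemma two_mult_divide_le_ln_one_plus:
  assumes "0 \<le> x"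
  shows "2 * x / (2 + x) \<le> ln (1 + x :: real)"
proof -
  define \<phi> where "\<phi> y = ln (1 + y) - 2 * y / (2 + y)" for y :: real
  have "\<exists>d. (\<phi> has_real_derivative d) (at y) \<and> 0 \<le> d" if y: "0 \<le> y" for y
  proof (intro exI conjI)
    show "(\<phi> has_real_derivative 1 / (1 + y) - 4 / (2 + y)\<^sup>2) (at y)"
      unfolding \<phi>_def using y
      by (auto intro!: derivative_eq_intros simp: power2_eq_square algebra_simps)
    have "4 * (1 + y) \<le> (2 + y)\<^sup>2" by (simp add: power2_eq_square algebra_simps)
    then show "0 \<le> 1 / (1 + y) - 4 / (2 + y)\<^sup>2"
      using y by (simp add: frac_le_eq field_simps)
  qed
  then have "\<phi> 0 \<le> \<phi> x"
    by (intro DERIV_nonneg_imp_nondecreasing[OF assms]) auto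
  then show ?thesis by (simp add: \<phi>_def)
qed

section \<open>Bounds for F = z D, P and Q when |z| >= 1 and 0 <= Arg z < pi/3\<close>

locale outer_sector =
  fixes r t :: real and z :: complex
  assumes r: "1 \<le> r" and t: "0 \<le> t" "t < pi / 3" and z: "z = rcis r t"
begin

lemma trig: "1 / 2 < cos t" "cos t \<le> 1" "0 \<le> sin t" "sin t \<le> t" "(cos t)\<^sup>2 + (sin t)\<^sup>2 = 1"
proof -
  have "pi / 3 \<le> pi" "t \<le> pi" using t pi_gt_zero by linarith+
  then show "1 / 2 < cos t" "0 \<le> sin t"
    using cos_monotone_0_pi[of t "pi / 3"] t by (simp_all add: cos_60 sin_ge_zero)
qed (use t in \<open>auto intro: sin_x_le_x\<close>)

lemma Re_z: "Re z = r * cos t" and Im_z: "Im z = r * sin t" and norm_z: "norm z = r"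
  using r by (simp_all add: z)

lemma Re_z_pos: "0 < Re z"
  using r trig by (simp add: Re_z)

lemma z_nonzero: "z \<noteq> 0" "1 + z \<noteq> 0"
  using Re_z_pos by (auto simp: complex_eq_iff)

lemma Ln_z: "Ln z = Complex (ln r) t"
proof -
  have e: "z = exp (of_real (ln r) + \<i> * of_real t)"
    using r by (simp add: z rcis_def exp_add cis_conv_exp exp_of_real)
  have "Ln z = of_real (ln r) + \<i> * of_real t"
  proof -
    have "- pi < t" "t \<le> pi" using t pi_gt_zero by linarith+
    then show ?thesis unfolding e by (intro Ln_exp) simp_all
  qed
  then show ?thesis by (simp add: complex_eq_iff)
qed

lemma norm_shift_sq: "(norm (z + of_real x))\<^sup>2 = r\<^sup>2 + 2 * r * x * cos t + x\<^sup>2"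
proof -
  have "(norm (z + of_real x))\<^sup>2 = (r * cos t + x)\<^sup>2 + (r * sin t)\<^sup>2"
    unfolding cmod_power2 by (simp add: Re_z Im_z)
  also have "\<dots> = r\<^sup>2 * ((cos t)\<^sup>2 + (sin t)\<^sup>2) + 2 * r * x * cos t + x\<^sup>2"
    by algebra
  finally show ?thesis unfolding trig(5) by simp
qed

text \<open>As cos t > 1/2, the squared norm is at least r^2 + r x + x^2, while the square of the
  left side is r^2 + r x + x^2/4.\<close>

lemma norm_shift_ge: "0 \<le> x \<Longrightarrow> r + x / 2 \<le> norm (z + of_real x)"
proof (rule power2_le_imp_le)
  assume x: "0 \<le> x"
  have "r * x * (1 / 2) \<le> r * x * cos t"
    using r x trig by (intro mult_left_mono) auto
  moreover have "x\<^sup>2 / 2\<^sup>2 \<le> x\<^sup>2" by simp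
  ultimately show "(r + x / 2)\<^sup>2 \<le> (norm (z + of_real x))\<^sup>2"
    unfolding norm_shift_sq power2_sum power_divide by linarith
qed simp

lemma norm_shift_le: "0 \<le> x \<Longrightarrow> norm (z + of_real x) \<le> r + x"
  using norm_triangle_ineq[of z "of_real x"] by (simp add: norm_z)

text \<open>\<open>1 + z\<close> is the sum of vectors with arguments 0 and \<open>t\<close>, and
  \<open>z\<close> is at least as long as 1, so the sum leans towards \<open>z\<close>.\<close>

lemma Arg_one_plus: "t / 2 \<le> Arg (1 + z)" "Arg (1 + z) \<le> t"
proof -
  have pos: "0 < Re (1 + z)" using Re_z_pos by simp
  have tt: "\<bar>t\<bar> < pi / 2" "\<bar>t / 2\<bar> < pi / 2" using t pi_gt_zero by linarith+
  have "sin t * (1 + r * cos t) \<ge> cos t * (r * sin t)"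
    using trig by (simp add: algebra_simps)
  then show "Arg (1 + z) \<le> t"
    using trig by (intro Arg_le_if[OF pos tt(1)]) (simp add: Re_z Im_z mult_ac)
  have "sin (t / 2) * (1 + r * cos t) \<le> cos (t / 2) * (r * sin t)"
  proof -
    have "0 \<le> sin (t / 2)" using t tt by (intro sin_ge_zero) linarith+
    then have "0 \<le> r * sin (t / 2) - sin (t / 2)"
      using r mult_right_mono[of 1 r "sin (t / 2)"] by simp
    moreover have "sin (t - t / 2) = sin t * cos (t / 2) - cos t * sin (t / 2)"
      by (rule sin_diff)
    then have "r * sin (t / 2) = r * (sin t * cos (t / 2) - cos t * sin (t / 2))"
      by simp
    ultimately show ?thesis by (simp add: algebra_simps)
  qed
  then show "t / 2 \<le> Arg (1 + z)"
    by (intro Arg_ge_if[OF pos tt(2)]) (simp add: Re_z Im_z mult_ac)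
qed

lemma Ln_one_plus:
  shows "t / 2 \<le> Im (Ln (1 + z))" "Im (Ln (1 + z)) \<le> Re (Ln (1 + z))"
    "Re (Ln (1 + z)) \<le> ln (1 + r)" "2 * r / (2 + r) \<le> norm (Ln (1 + z))"
    "0 < Re (Ln (1 + z))"
proof -
  show "t / 2 \<le> Im (Ln (1 + z))"
    using Arg_one_plus(1) z_nonzero by (simp add: Arg_eq_Im_Ln)
  show "Im (Ln (1 + z)) \<le> Re (Ln (1 + z))"
    unfolding z using r t by (intro Im_Ln_one_plus_rcis_le) auto
  show "Re (Ln (1 + z)) \<le> ln (1 + r)"
    using norm_shift_le[of 1] z_nonzero r by (simp add: add.commute)
  show "2 * r / (2 + r) \<le> norm (Ln (1 + z))"
    using two_mult_divide_le_ln_one_plus[of r] ln_one_plus_norm_le[of z] r z_nonzero by (simp add: norm_z)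
  have "1 < norm (1 + z)"
    using norm_shift_ge[of 1] r by (simp add: add.commute)
  then show "0 < Re (Ln (1 + z))"
    using z_nonzero by simp
qed

lemma shift_pos: "0 \<le> x \<Longrightarrow> 0 < (norm (z + of_real x))\<^sup>2"
  using norm_shift_ge[of x] r by (auto simp: zero_less_power2)

lemma
  shows Re_inverse_shift: "Re (1 / (z + of_real x)) = (r * cos t + x) / (norm (z + of_real x))\<^sup>2"
    and Im_inverse_shift: "Im (1 / (z + of_real x)) = - (r * sin t) / (norm (z + of_real x))\<^sup>2"
    and Re_divide_shift: "Re (z * (1 / (z + of_real x))) = (r\<^sup>2 + x * r * cos t) / (norm (z + of_real x))\<^sup>2"
    and Im_divide_shift: "Im (z * (1 / (z + of_real x))) = x * r * sin t / (norm (z + of_real x))\<^sup>2"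
proof -
  show 1: "Re (1 / (z + of_real x)) = (r * cos t + x) / (norm (z + of_real x))\<^sup>2"
    and 2: "Im (1 / (z + of_real x)) = - (r * sin t) / (norm (z + of_real x))\<^sup>2"
    unfolding cmod_power2 by (simp_all add: Re_divide Im_divide Re_z Im_z)
  have "r * cos t * (r * cos t + x) + r * sin t * (r * sin t) = r\<^sup>2 * ((cos t)\<^sup>2 + (sin t)\<^sup>2) + x * r * cos t"
    by algebra
  also have "\<dots> = r\<^sup>2 + x * r * cos t" unfolding trig(5) by simp
  finally show "Re (z * (1 / (z + of_real x))) = (r\<^sup>2 + x * r * cos t) / (norm (z + of_real x))\<^sup>2"
    unfolding times_complex.sel 1 2 Re_z Im_z
    by (simp add: add_divide_distrib[symmetric])
  show "Im (z * (1 / (z + of_real x))) = x * r * sin t / (norm (z + of_real x))\<^sup>2"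
    unfolding times_complex.sel 1 2 Re_z Im_z
    by (simp add: diff_divide_distrib[symmetric] algebra_simps)
qed

lemma norm_shift_sq_le: "0 \<le> x \<Longrightarrow> x \<le> 1 \<Longrightarrow> (norm (z + of_real x))\<^sup>2 \<le> (r + 1)\<^sup>2"
  using norm_shift_le[of x] by (intro power_mono) auto

lemma z_Ln:
  defines "F \<equiv> z * Ln (1 + 1 / z)"
  shows "0 < Re F" "0 \<le> Im F" "(r + cos t) * Im F \<le> sin t * Re F" "norm F \<le> (4 * r + 1) / (4 * r + 2)"
proof -
  have F: "((\<lambda>x. z * (1 / (z + of_real x))) has_integral F) {0..1}"
    unfolding F_def by (intro has_integral_mult_right has_integral_inverse_shift Re_z_pos)
  note lower = has_integral_Re_ge[OF F has_integral_affine_unit]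
  have "r\<^sup>2 / (r + 1)\<^sup>2 + 0 / 2 \<le> Re (1 * F)"
  proof (rule lower)
    fix x :: real assume x: "x \<in> {0..1}"
    have "r\<^sup>2 / (r + 1)\<^sup>2 \<le> (r\<^sup>2 + x * r * cos t) / (norm (z + of_real x))\<^sup>2"
      using x r trig shift_pos[of x] norm_shift_sq_le[of x] by (intro frac_le) auto
    then show "r\<^sup>2 / (r + 1)\<^sup>2 + 0 * x \<le> Re (1 * (z * (1 / (z + of_real x))))"
      using Re_divide_shift[of x] by simp
  qed
  moreover have "0 < r\<^sup>2 / (r + 1)\<^sup>2" using r by simp
  ultimately show "0 < Re F" by simp
  have Re_minus_ii: "Re (- \<i> * w) = Im w" for w by simp
  have "0 + 0 / 2 \<le> Re (- \<i> * F)"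
  proof (rule lower)
    fix x :: real assume x: "x \<in> {0..1}"
    have "0 \<le> x * r * sin t / (norm (z + of_real x))\<^sup>2"
      using x r trig by simp
    then show "0 + 0 * x \<le> Re (- \<i> * (z * (1 / (z + of_real x))))"
      unfolding Re_minus_ii Im_divide_shift by simp
  qed
  then show "0 \<le> Im F" by simp
  \<comment> \<open>The claim is that Arg F is at most the argument of z/(z + 1), the integrand at
    the endpoint x = 1, where that argument is largest.\<close>
  have "0 + 0 / 2 \<le> Re (Complex (sin t) (r + cos t) * F)"
  proof (rule lower)
    fix x :: real assume x: "x \<in> {0..1}"
    have "sin t * (r\<^sup>2 + x * r * cos t) - (r + cos t) * (x * r * sin t) = sin t * r\<^sup>2 * (1 - x)"
      by (simp add: power2_eq_square algebra_simps)
    moreover have "0 \<le> sin t * r\<^sup>2 * (1 - x)" using x trig by simp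
    ultimately have "0 \<le> (sin t * (r\<^sup>2 + x * r * cos t) - (r + cos t) * (x * r * sin t)) / (norm (z + of_real x))\<^sup>2"
      by simp
    then show "0 + 0 * x \<le> Re (Complex (sin t) (r + cos t) * (z * (1 / (z + of_real x))))"
      unfolding times_complex.sel(1)[of "Complex (sin t) (r + cos t)"] Re_divide_shift Im_divide_shift
      by (simp add: diff_divide_distrib)
  qed
  then show "(r + cos t) * Im F \<le> sin t * Re F" by simp
  \<comment> \<open>The majorant r/(r + x/2) is convex in x; the affine bound is its chord on
    [0,1].\<close>
  have "norm F \<le> 1 + (- 1 / (2 * r + 1)) / 2"
  proof (rule has_integral_norm_le[OF F has_integral_affine_unit])
    fix x :: real assume x: "x \<in> {0..1}"
    have "0 < norm (z + of_real x)" using x r norm_shift_ge[of x] by auto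
    then have "norm (z * (1 / (z + of_real x))) \<le> r / (r + x / 2)"
      using x r norm_shift_ge[of x] by (auto simp: norm_mult norm_divide norm_z intro!: divide_left_mono mult_pos_pos)
    also have "\<dots> \<le> 1 + - 1 / (2 * r + 1) * x"
    proof -
      have "x * x \<le> x" using x mult_left_mono[of x 1 x] by simp
      then show ?thesis using x r by (simp add: divide_simps) (simp add: algebra_simps)
    qed
    finally show "norm (z * (1 / (z + of_real x))) \<le> 1 + - 1 / (2 * r + 1) * x" .
  qed
  also have "\<dots> = (4 * r + 1) / (4 * r + 2)" using r by (simp add: field_simps)
  finally show "norm F \<le> (4 * r + 1) / (4 * r + 2)" .
qed

lemma P_bounds:
  shows "0 < Re (P z)" "Im (P z) \<le> 0" "0 \<le> sin t * Re (P z) + cos t * Im (P z)"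
    "norm (P z) \<le> 1 / (2 * r)"
proof -
  have P: "((\<lambda>x. of_real (1 - x) / (z + of_real x)) has_integral P z) {0..1}"
    unfolding P_def by (intro has_integral_weighted_inverse_shift Re_z_pos)
  have Re_eq: "Re (of_real (1 - x) / (z + of_real x)) = (1 - x) * ((r * cos t + x) / (norm (z + of_real x))\<^sup>2)"
    and Im_eq: "Im (of_real (1 - x) / (z + of_real x)) = (1 - x) * (- (r * sin t) / (norm (z + of_real x))\<^sup>2)" for x
  proof -
    have "of_real (1 - x) / (z + of_real x) = of_real (1 - x) * (1 / (z + of_real x))"
      by simp
    then show "Re (of_real (1 - x) / (z + of_real x)) = (1 - x) * ((r * cos t + x) / (norm (z + of_real x))\<^sup>2)"
      "Im (of_real (1 - x) / (z + of_real x)) = (1 - x) * (- (r * sin t) / (norm (z + of_real x))\<^sup>2)"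
      by (simp_all only: times_complex.sel Re_inverse_shift Im_inverse_shift) simp_all
  qed
  note lower = has_integral_Re_ge[OF P has_integral_affine_unit]
  define m where "m = r * cos t / (r + 1)\<^sup>2"
  have "m + (- m) / 2 \<le> Re (1 * P z)"
  proof (rule lower)
    fix x :: real assume x: "x \<in> {0..1}"
    have "m \<le> (r * cos t + x) / (norm (z + of_real x))\<^sup>2"
      unfolding m_def
      using x r trig shift_pos[of x] norm_shift_sq_le[of x] by (intro frac_le) auto
    then have "(1 - x) * m \<le> (1 - x) * ((r * cos t + x) / (norm (z + of_real x))\<^sup>2)"
      using x by (intro mult_left_mono) auto
    then show "m + - m * x \<le> Re (1 * (of_real (1 - x) / (z + of_real x)))"
      unfolding mult_1 Re_eq by (simp add: algebra_simps)
  qed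
  moreover have "0 < m" unfolding m_def using r trig by (intro divide_pos_pos mult_pos_pos) auto
  ultimately show "0 < Re (P z)" by simp
  have "0 + 0 / 2 \<le> Re (\<i> * P z)"
  proof (rule lower)
    fix x :: real assume x: "x \<in> {0..1}"
    have "0 \<le> (1 - x) * (r * sin t / (norm (z + of_real x))\<^sup>2)"
      using x r trig by simp
    then show "0 + 0 * x \<le> Re (\<i> * (of_real (1 - x) / (z + of_real x)))"
      unfolding Re_i_times Im_eq by simp
  qed
  then show "Im (P z) \<le> 0" by simp
  \<comment> \<open>This real part is the imaginary part of \<open>cis t * P z\<close>; it is
    nonnegative because \<open>z + x\<close> has argument at most \<open>t\<close> for x >=
    0.\<close>
  have "0 + 0 / 2 \<le> Re (Complex (sin t) (- cos t) * P z)"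
  proof (rule lower)
    fix x :: real assume x: "x \<in> {0..1}"
    have "0 \<le> (1 - x) * (sin t * x) / (norm (z + of_real x))\<^sup>2"
      using x trig by simp
    also have "\<dots> = sin t * ((1 - x) * ((r * cos t + x) / (norm (z + of_real x))\<^sup>2))
        - (- cos t) * ((1 - x) * (- (r * sin t) / (norm (z + of_real x))\<^sup>2))"
      by (simp add: add_divide_distrib diff_divide_distrib algebra_simps)
    finally show "0 + 0 * x \<le> Re (Complex (sin t) (- cos t) * (of_real (1 - x) / (z + of_real x)))"
      unfolding times_complex.sel(1)[of "Complex (sin t) (- cos t)"] complex.sel Re_eq Im_eq by simp
  qed
  then show "0 \<le> sin t * Re (P z) + cos t * Im (P z)" by simp
  have "norm (P z) \<le> 1 / r + (- 1 / r) / 2"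
  proof (rule has_integral_norm_le[OF P has_integral_affine_unit])
    fix x :: real assume x: "x \<in> {0..1}"
    have "r \<le> norm (z + of_real x)" using x norm_shift_ge[of x] by simp
    then have "norm (of_real (1 - x) / (z + of_real x)) \<le> (1 - x) / r"
      unfolding norm_divide norm_of_real using x r by (intro frac_le) auto
    then show "norm (of_real (1 - x) / (z + of_real x)) \<le> 1 / r + - 1 / r * x"
      using r by (simp add: field_simps)
  qed
  also have "\<dots> = 1 / (2 * r)" using r by (simp add: field_simps)
  finally show "norm (P z) \<le> 1 / (2 * r)" .
qed

text \<open>With Q = F/M, the argument of F lies between 0 and that of M, and the latter is at most
  pi/4. Hence Arg Q lies in [-pi/4, 0].\<close>

lemma Q_bounds:
  shows "0 < Re (Q z)" "Im (Q z) \<le> 0" "0 \<le> Re (Q z) + Im (Q z)" "norm (Q z) \<le> 5 / 4"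
proof -
  define F M where "F = z * Ln (1 + 1 / z)" and "M = Ln (1 + z)"
  have Q: "Q z = F / M" by (simp add: Q_def F_def M_def)
  note F = z_Ln[folded F_def] and M = Ln_one_plus[folded M_def]
  have N: "0 < (Re M)\<^sup>2 + (Im M)\<^sup>2" using M(5) by (simp add: add_pos_nonneg)
  have M2: "0 \<le> Im M" using M(1) t by simp
  have ReQ: "Re (Q z) = (Re F * Re M + Im F * Im M) / ((Re M)\<^sup>2 + (Im M)\<^sup>2)"
    and ImQ: "Im (Q z) = (Im F * Re M - Re F * Im M) / ((Re M)\<^sup>2 + (Im M)\<^sup>2)"
    by (simp_all add: Q Re_divide Im_divide)
  show "0 < Re (Q z)"
    unfolding ReQ using N F(1,2) M(5) M2 by (intro divide_pos_pos add_pos_nonneg) auto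
  have "Im F * Re M \<le> Re F * Im M"
  proof -
    \<comment> \<open>Splitting off ln 2 <= 25/36 is sharp enough: 25/18 - 1 = 7/18 < 1/2 < cos
      t.\<close>
    have "2 * ln (1 + r) \<le> r + cos t"
    proof -
      have "ln (1 + r) = ln (2 * (1 + (r - 1) / 2))"
        by (rule arg_cong[where f = ln]) (simp add: field_simps)
      also have "\<dots> = ln 2 + ln (1 + (r - 1) / 2)"
        using r by (intro ln_mult_pos) (simp_all add: add_pos_nonneg)
      also have "\<dots> \<le> 25 / 36 + (r - 1) / 2"
        using r ln2_le_25_over_36 by (intro add_mono ln_add_one_self_le_self) auto
      finally have "2 * ln (1 + r) \<le> 25 / 18 - 1 + r" by (simp add: diff_divide_distrib)
      then show ?thesis using trig(1) by linarith
    qed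
    then have "2 * Re M \<le> r + cos t" using M(3) by linarith
    then have "2 * (Im F * Re M) \<le> (r + cos t) * Im F"
      using F(2) mult_right_mono[of "2 * Re M" "r + cos t" "Im F"] by (simp add: mult_ac)
    also have "\<dots> \<le> sin t * Re F" by (rule F(3))
    also have "\<dots> \<le> (2 * Im M) * Re F"
      using trig M(1) F(1) by (intro mult_right_mono) auto
    finally show ?thesis by (simp add: mult_ac)
  qed
  then show "Im (Q z) \<le> 0"
    unfolding ImQ using N by (simp add: divide_le_0_iff)
  have "Re F * Im M \<le> Re F * Re M" using F(1) M(2) by (intro mult_left_mono) auto
  moreover have "0 \<le> Im F * Im M" "0 \<le> Im F * Re M" using F(2) M(5) M2 by auto
  ultimately show "0 \<le> Re (Q z) + Im (Q z)"
    unfolding ReQ ImQ add_divide_distrib[symmetric] using N by (intro divide_nonneg_pos) auto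
  \<comment> \<open>The right side decreases in r; 5/4 is its value at r = 1, whence the factor r -
    1 below.\<close>
  have "norm (Q z) \<le> ((4 * r + 1) / (4 * r + 2)) / (2 * r / (2 + r))"
    unfolding Q norm_divide using r F(4) M(4) by (intro frac_le) auto
  also have "\<dots> \<le> 5 / 4"
  proof -
    have "r * (r * 12) - (4 + r * 8) = (r - 1) * (12 * r + 4)" by (simp add: algebra_simps)
    also have "\<dots> \<ge> 0" using r by simp
    finally show ?thesis using r by (simp add: divide_simps) (simp add: algebra_simps)
  qed
  finally show "norm (Q z) \<le> 5 / 4" .
qed

lemma Arg_P: "- t \<le> Arg (P z)" "Arg (P z) \<le> 0"
proof -
  have tt: "\<bar>- t\<bar> < pi / 2" "\<bar>0::real\<bar> < pi / 2" using t pi_gt_zero by linarith+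
  show "- t \<le> Arg (P z)"
    using P_bounds(3) by (intro Arg_ge_if[OF P_bounds(1) tt(1)]) (simp add: mult_ac)
  show "Arg (P z) \<le> 0"
    using P_bounds(2) by (intro Arg_le_if[OF P_bounds(1) tt(2)]) simp
qed

section \<open>Positivity of the rotated derivative for |z| >= 1 and after inversion\<close>

text \<open>In the decomposition \<open>Q_times_K\<close>, rotation by pi/3 brings the argument of
  the first summand into [-pi/2, pi/2] and that of the second strictly inside; the second gives
  strictness.\<close>

lemma Re_rotated_Q_times_K: "0 < Re (cis (pi / 3) * (Q z * K z))"
proof -
  define Y where "Y = Q z + 1 - P z"
  have nP: "norm (P z) \<le> 1 / 2"
    using P_bounds(4) r order_trans[of "norm (P z)" "1 / (2 * r)" "1 / 2"] by (simp add: field_simps)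
  have ReP: "Re (P z) \<le> 1 / 2" using nP complex_Re_le_cmod[of "P z"] by linarith
  \<comment> \<open>The left side is twice the real part of \<open>cis (pi / 3) * P z\<close>. The
    bound 1 is what Arg Y <= pi/6 requires.\<close>
  have P12: "Re (P z) - sqrt 3 * Im (P z) \<le> 1"
  proof -
    have "Re (cis (pi / 3) * P z) \<le> norm (cis (pi / 3) * P z)" by (rule complex_Re_le_cmod)
    then show ?thesis using nP by (simp add: norm_mult cos_60 sin_60)
  qed
  have ReY: "0 < Re Y" using ReP Q_bounds(1) by (simp add: Y_def)
  have Arg_Q: "- (pi / 4) \<le> Arg (Q z)" "Arg (Q z) \<le> 0"
    using Q_bounds Arg_le_if[of "Q z" 0] by (auto intro: Arg_ge_minus_pi_quarter)
  have Arg_Y: "- (pi / 4) \<le> Arg Y" "Arg Y \<le> pi / 6"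
  proof -
    show "- (pi / 4) \<le> Arg Y"
      using Q_bounds P_bounds ReP ReY by (intro Arg_ge_minus_pi_quarter) (auto simp: Y_def)
    have "sqrt 3 * Im Y \<le> Re Y"
    proof -
      have "sqrt 3 * Im (Q z) \<le> 0" using Q_bounds(2) by (simp add: mult_nonneg_nonpos)
      then show ?thesis using P12 Q_bounds(1) by (simp add: Y_def algebra_simps)
    qed
    then show "Arg Y \<le> pi / 6"
      using ReY by (intro Arg_le_if) (auto simp: cos_30 sin_30 mult_ac)
  qed
  have "0 \<le> Re (cis (pi / 3) * (Q z * Y / (1 + z)))"
    unfolding Re_cis_mult_divide[OF z_nonzero(2)]
    using Arg_Q Arg_Y Arg_one_plus t by (intro mult_nonneg_nonneg cos_ge_zero) auto
  moreover have "0 < Re (cis (pi / 3) * (P z * z / (1 + z)))"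
  proof -
    have "Arg z = t" using t r by (auto simp: z intro!: Arg_rcis)
    moreover have "P z \<noteq> 0" using P_bounds(1) by auto
    ultimately show ?thesis
      unfolding Re_cis_mult_divide[OF z_nonzero(2)]
      using Arg_P Arg_one_plus t z_nonzero
      by (intro mult_pos_pos cos_gt_zero_pi divide_pos_pos) auto
  qed
  ultimately show ?thesis
    by (simp add: Q_times_K[OF Re_z_pos] Y_def distrib_left)
qed

text \<open>Since |Arg P| <= pi/3, the real part of P is at least p/2, so |1 + P| >= 1 + p/2. The
  quotient p/(1 + p/2) increases in p and is evaluated at p = 1/(2r).\<close>

lemma norm_P_ratio_le: "norm (P z / (1 + P z)) \<le> 1 / (2 * r + 1 / 2)"
proof -
  define p where "p = norm (P z)"
  have p: "0 < p" "2 * r * p \<le> 1"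
    using P_bounds(1,4) r by (auto simp: p_def field_simps)
  have "p / 2 \<le> Re (P z)"
  proof -
    have "cos (pi / 3) \<le> cos (- Arg (P z))"
      using Arg_P t by (intro cos_monotone_0_pi_le) auto
    then have "p * (1 / 2) \<le> p * cos (Arg (P z))"
      using p by (intro mult_left_mono) (auto simp: cos_60)
    then show ?thesis using Re_cis_mult[of 0 "P z"] by (simp add: p_def)
  qed
  have "1 + p / 2 \<le> norm (1 + P z)"
  proof (rule power2_le_imp_le)
    have "(norm (1 + P z))\<^sup>2 = 1 + 2 * Re (P z) + p\<^sup>2"
      unfolding p_def cmod_power2 by (simp add: power2_eq_square algebra_simps)
    also have "\<dots> \<ge> 1 + p + p\<^sup>2" using \<open>p / 2 \<le> Re (P z)\<close> by simp
    finally have "1 + p + p\<^sup>2 \<le> (norm (1 + P z))\<^sup>2" .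
    moreover have "(1 + p / 2)\<^sup>2 = 1 + p + p\<^sup>2 / 4"
      by (simp add: power2_eq_square field_simps)
    ultimately show "(1 + p / 2)\<^sup>2 \<le> (norm (1 + P z))\<^sup>2"
      using zero_le_power2[of p] by linarith
  qed simp
  then have "norm (P z / (1 + P z)) \<le> p / (1 + p / 2)"
    unfolding norm_divide p_def[symmetric] using p by (intro divide_left_mono mult_pos_pos) auto
  also have "\<dots> \<le> 1 / (2 * r + 1 / 2)"
    using p r by (simp add: field_simps)
  finally show ?thesis .
qed

text \<open>This is the positivity claim at the reflected point \<open>cnj (1 / z)\<close>, where Q
  K is the conjugate of (2 - K)/Q. The rotated numerator has argument in (-pi/2, pi/4), and division
  by Q adds an angle in [0, pi/4].\<close>

lemma Re_rotated_two_minus_K_divide_Q: "0 < Re (cis (- pi / 3) * ((2 - K z) / Q z))"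
proof -
  define T1 T2 Y where "T1 = (1 + Q z) / (1 + z)" and "T2 = Ln z * (P z / (1 + P z))"
    and "Y = 2 - K z"
  have Y: "Y = 2 - T1 - T2"
  proof -
    have "P z \<noteq> - 1" using P_bounds(1) by auto
    then show ?thesis by (simp add: K_eq[OF Re_z_pos] Y_def T1_def T2_def)
  qed
  have T2: "norm T2 \<le> (r + 1 / 15) / (2 * r + 1 / 2)"
  proof -
    have "norm (Ln z) \<le> \<bar>ln r\<bar> + \<bar>t\<bar>"
      using cmod_le[of "Ln z"] by (simp add: Ln_z)
    \<comment> \<open>From ln r <= r - 1 and t < pi/3 < 16/15.\<close>
    also have "\<dots> \<le> r + 1 / 15"
      using r t ln_le_minus_one[of r] pi_approx by simp
    finally have "norm T2 \<le> (r + 1 / 15) * (1 / (2 * r + 1 / 2))"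
      unfolding T2_def norm_mult using norm_P_ratio_le r by (intro mult_mono) auto
    then show ?thesis by simp
  qed
  define N where "N = 1 + 2 * r * cos t + r\<^sup>2"
  have N: "(norm (1 + z))\<^sup>2 = N"
    using norm_shift_sq[of 1] by (simp add: N_def add.commute)
  have Npos: "0 < N" using r trig by (auto simp: N_def intro!: add_pos_nonneg)
  define x y where "x = (1 + r * cos t) / N" and "y = r * sin t / N"
  have xy: "1 / (1 + z) = Complex x (- y)"
    using Re_inverse_shift[of 1] Im_inverse_shift[of 1] N
    by (simp add: complex_eq_iff x_def y_def add.commute)
  have x: "0 \<le> x" "x \<le> 1 / (1 + r)" and y: "0 \<le> y"
  proof -
    have "0 \<le> (1 - cos t) * (r - 1) * r" using r trig by simp
    then have "(1 + r * cos t) * (1 + r) \<le> N"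
      by (simp add: N_def power2_eq_square algebra_simps)
    then show "x \<le> 1 / (1 + r)" using r Npos by (simp add: x_def field_simps)
  qed (use r trig Npos in \<open>auto simp: x_def y_def\<close>)
  have "T1 = (1 + Q z) * Complex x (- y)" by (simp add: T1_def xy[symmetric])
  then have ReT1: "Re T1 = (1 + Re (Q z)) * x + Im (Q z) * y"
    and ImT1: "Im T1 = Im (Q z) * x - (1 + Re (Q z)) * y" by simp_all
  have "Re (Q z) \<le> 5 / 4" using Q_bounds(4) complex_Re_le_cmod[of "Q z"] by linarith
  then have "(1 + Re (Q z)) * x \<le> (9 / 4) * (1 / (1 + r))"
    using x Q_bounds(1) by (intro mult_mono) auto
  moreover have "Im (Q z) * y \<le> 0" "Im (Q z) * x \<le> 0" "0 \<le> (1 + Re (Q z)) * y"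
    using Q_bounds x y by (auto simp: mult_nonpos_nonneg)
  ultimately have T1: "Re T1 \<le> 9 / (4 * (1 + r))" "Im T1 \<le> 0"
    unfolding ReT1 ImT1 by (auto simp: field_simps)
  \<comment> \<open>Nearly tight at r = 1, where the sides are 64/75 and 7/8; expanding around r = 1
    exhibits the sign.\<close>
  have key: "2 * ((r + 1 / 15) / (2 * r + 1 / 2)) < 2 - 9 / (4 * (1 + r))"
  proof -
    have "2 - 9 / (4 * (1 + r)) - 2 * ((r + 1 / 15) / (2 * r + 1 / 2)) =
        ((r - 1) * (8 * r + 22 / 15) + 13 / 30) / (4 * (1 + r) * (2 * r + 1 / 2))"
      using r by (simp add: divide_simps) (simp add: algebra_simps)
    also have "\<dots> > 0" using r by (intro divide_pos_pos add_nonneg_pos) auto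
    finally show ?thesis by simp
  qed
  have half: "2 * norm T2 < 2 - Re T1" using T2 T1 key by linarith
  \<comment> \<open>The left side is twice the real part of T2 rotated by -pi/3.\<close>
  have "Re T2 + sqrt 3 * Im T2 \<le> 2 * norm T2"
    using complex_Re_le_cmod[of "cis (- pi / 3) * T2"] by (simp add: norm_mult cos_60 sin_60)
  moreover have "sqrt 3 * Im T1 \<le> 0" using T1 by (simp add: mult_nonneg_nonpos)
  moreover have "Re Y + sqrt 3 * Im Y = 2 - Re T1 - sqrt 3 * Im T1 - (Re T2 + sqrt 3 * Im T2)"
    by (simp add: Y algebra_simps)
  ultimately have p': "0 < Re Y + sqrt 3 * Im Y" using half by linarith
  then have p: "0 < Re (cis (- pi / 3) * Y)" by (simp add: cos_60 sin_60)
  have ReY: "0 < Re Y"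
  proof -
    have "Re Y = 2 - Re T1 - Re T2" by (simp add: Y)
    then show ?thesis using half complex_Re_le_cmod[of T2] norm_ge_zero[of T2] by linarith
  qed
  have pq: "0 < Re (cis (- pi / 3) * Y) - Im (cis (- pi / 3) * Y)"
  proof -
    have s: "1 < sqrt 3" by simp
    \<comment> \<open>Up to a positive factor, the target is a positive combination of the two
      quantities already known to be positive.\<close>
    have "sqrt 3 * (sqrt 3 * Re Y + Re Y + (sqrt 3 * Im Y - Im Y)) =
        (sqrt 3 - 1) * (Re Y + sqrt 3 * Im Y) + 4 * Re Y"
      by (simp add: algebra_simps)
    also have "\<dots> > 0"
    proof -
      have "0 < (sqrt 3 - 1) * (Re Y + sqrt 3 * Im Y)"
        using mult_pos_pos[of "sqrt 3 - 1" "Re Y + sqrt 3 * Im Y"] s p' by simp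
      then show ?thesis using ReY by linarith
    qed
    finally have "0 < sqrt 3 * Re Y + Re Y + (sqrt 3 * Im Y - Im Y)"
      by (simp add: zero_less_mult_iff)
    then show ?thesis by (simp add: cos_60 sin_60 field_simps)
  qed
  define W where "W = cis (- pi / 3) * Y"
  have W: "0 < Re W" "0 < Re W - Im W" using p pq by (simp_all only: W_def)
  have q: "0 < (Re (Q z))\<^sup>2 + (Im (Q z))\<^sup>2" using Q_bounds(1) by (simp add: add_pos_nonneg)
  \<comment> \<open>The sum equals Re W (Re Q + Im Q) + (Re W - Im W)(- Im Q). If Im Q = 0 the
    second term vanishes, so strictness then comes from Re W Re Q.\<close>
  have "0 < Re W * Re (Q z) + Im W * Im (Q z)"
  proof (cases "Im (Q z) = 0")
    case True
    then show ?thesis using W(1) Q_bounds(1) by simp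
  next
    case False
    then have "0 < (Re W - Im W) * (- Im (Q z))"
      using W(2) Q_bounds(2) by (intro mult_pos_pos) auto
    moreover have "0 \<le> Re W * (Re (Q z) + Im (Q z))"
      using W(1) Q_bounds(3) by (intro mult_nonneg_nonneg) auto
    ultimately show ?thesis by (simp add: algebra_simps)
  qed
  then have "0 < Re (W / Q z)"
    unfolding Re_divide using q by simp
  then show ?thesis by (simp add: W_def Y_def)
qed

text \<open>The product regroups as X F with X = \<open>Ln z / M\<close>; X has nonnegative real and
  positive imaginary part, F positive real and nonnegative imaginary part.\<close>

lemma Im_Ln_times_Q_pos:
  assumes "0 < t"
  shows "0 < Im (Ln z * Q z)"
proof -
  define F M where "F = z * Ln (1 + 1 / z)" and "M = Ln (1 + z)"
  note F = z_Ln[folded F_def] and M = Ln_one_plus[folded M_def]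
  define X where "X = Ln z / M"
  have M0: "M \<noteq> 0" using M(5) by auto
  have "Ln z * Q z = X * F" by (simp add: X_def Q_def F_def M_def)
  have "0 \<le> Re X"
    unfolding X_def Re_divide using M(1,5) r t by (auto simp: Ln_z)
  moreover have "0 < Im X"
  proof -
    \<comment> \<open>This reduces Im X > 0 to Arg Q <= 0 < Arg z.\<close>
    have "X = 1 - Q z / z"
      unfolding X_def Q_def Ln_one_plus_inverse[OF Re_z_pos] M_def[symmetric]
      using M0 z_nonzero by (simp add: field_simps)
    then have "Im X = (Re (Q z) * (r * sin t) - Im (Q z) * (r * cos t)) / ((r * cos t)\<^sup>2 + (r * sin t)\<^sup>2)"
      by (simp add: Im_divide Re_z Im_z minus_divide_left)
    moreover have "0 < Re (Q z) * (r * sin t)"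
      using Q_bounds(1) r assms t by (auto intro!: mult_pos_pos sin_gt_zero)
    moreover have "Im (Q z) * (r * cos t) \<le> 0"
      using Q_bounds(2) r trig by (intro mult_nonpos_nonneg) auto
    moreover have "0 < (r * cos t)\<^sup>2 + (r * sin t)\<^sup>2"
      using r trig by (intro add_pos_nonneg) auto
    ultimately show ?thesis by (auto intro!: divide_pos_pos)
  qed
  ultimately have "0 < Im (X * F)"
    using F(1,2) by (simp add: add_nonneg_pos)
  then show ?thesis using \<open>Ln z * Q z = X * F\<close> by simp
qed

text \<open>Needed at the reflected point \<open>cnj (1 / z)\<close>, where G is the conjugate of
  -(Ln z / Q z).\<close>

lemma Im_Ln_divide_Q_pos:
  assumes "0 < t"
  shows "0 < Im (Ln z / Q z)"
proof -
  have "0 < (Re (Q z))\<^sup>2 + (Im (Q z))\<^sup>2" using Q_bounds(1) by (simp add: add_pos_nonneg)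
  moreover have "0 < t * Re (Q z)" using assms Q_bounds(1) by simp
  moreover have "ln r * Im (Q z) \<le> 0" using r Q_bounds(2) by (simp add: mult_nonneg_nonpos)
  ultimately show ?thesis by (simp add: Im_divide Ln_z)
qed

end

section \<open>Conjugation symmetry and transfer to the whole upper half of the sector\<close>

lemma
  assumes "0 < Re z"
  shows Q_cnj: "Q (cnj z) = cnj (Q z)" and K_cnj: "K (cnj z) = cnj (K z)"
    and G_cnj: "G (cnj z) = cnj (G z)"
proof -
  have pos: "0 < Re (1 + z)" using assms by simp
  have "z \<noteq> 0" using assms by auto
  then have "Re (1 / z) = Re z / (norm z)\<^sup>2"
    unfolding cmod_power2 by (simp add: Re_divide)
  then have "0 < Re (1 + 1 / z)"
    using assms by (simp add: add_pos_nonneg)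
  note cnj_Ln' = cnj_Ln[OF Re_pos_not_nonpos_Reals]
  have "Ln (1 + cnj z) = cnj (Ln (1 + z))" "Ln (1 + 1 / cnj z) = cnj (Ln (1 + 1 / z))"
    "Ln (cnj z) = cnj (Ln z)"
    using cnj_Ln'[OF pos] cnj_Ln'[OF \<open>0 < Re (1 + 1 / z)\<close>] cnj_Ln'[OF assms] by simp_all
  then show "Q (cnj z) = cnj (Q z)" "K (cnj z) = cnj (K z)" "G (cnj z) = cnj (G z)"
    by (simp_all add: Q_def K_def G_def)
qed

text \<open>Contains the positive real axis, so that it and its conjugate cover the full
  sector.\<close>

definition upper_sector :: "complex set" where
  "upper_sector = {z. z \<noteq> 0 \<and> 0 \<le> Arg z \<and> Arg z < pi / 3}"

lemma Re_pos_if_Arg: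
  assumes "z \<noteq> 0" "\<bar>Arg z\<bar> < pi / 3"
  shows "0 < Re z"
proof -
  have "- (pi / 2) < Arg z" "Arg z < pi / 2" using assms pi_gt_zero by linarith+
  then have "0 < cos (Arg z)" by (intro cos_gt_zero_pi)
  then show ?thesis using assms(1) Re_cis_mult[of 0 z] by simp
qed

lemma
  assumes "z \<in> upper_sector"
  shows Re_rotated_log_deriv_pos: "0 < Re (cis (pi / 3) * (Q z * K z))"
    and Im_G_pos: "0 < Arg z \<Longrightarrow> 0 < Im (G z)"
proof -
  have z: "z \<noteq> 0" "0 \<le> Arg z" "Arg z < pi / 3"
    using assms by (auto simp: upper_sector_def)
  then have pos_z: "0 < Re z" by (intro Re_pos_if_Arg) auto
  have "0 < Re (cis (pi / 3) * (Q z * K z)) \<and> (0 < Arg z \<longrightarrow> 0 < Im (G z))"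
  proof (cases "1 \<le> norm z")
    case True
    interpret outer_sector "norm z" "Arg z" z
      using True z by unfold_locales (simp_all add: rcis_cmod_Arg)
    show ?thesis
      unfolding G_eq_Ln_Q[OF pos_z] using Re_rotated_Q_times_K Im_Ln_times_Q_pos by blast
  next
    case False
    \<comment> \<open>Reflection in the unit circle: \<open>w\<close> is 1 / cnj z, with the same
      argument as \<open>z\<close> and modulus above 1.\<close>
    define w where "w = rcis (1 / norm z) (Arg z)"
    interpret w: outer_sector "1 / norm z" "Arg z" w
      using False z by unfold_locales (simp_all add: w_def field_simps)
    have "1 / cnj w = rcis (norm z) (Arg z)"
      using z(1) by (simp add: w_def rcis_def cis_cnj cis_divide[symmetric] field_simps cis_mult)
    then have zw: "z = cnj (1 / w)" by (simp add: rcis_cmod_Arg)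
    have pos: "0 < Re (1 / w)" using pos_z by (simp only: zw cnj.sel)
    have Ln: "Ln (1 / w) = - Ln w"
      using Ln_inverse[OF Re_pos_not_nonpos_Reals[OF w.Re_z_pos]] by (simp add: inverse_eq_divide)
    have "Q z * K z = cnj ((2 - K w) / Q w)"
      unfolding zw Q_cnj[OF pos] K_cnj[OF pos] Q_inverse[OF w.Re_z_pos] K_inverse[OF w.Re_z_pos] by simp
    moreover have "cis (pi / 3) * cnj X = cnj (cis (- pi / 3) * X)" for X
      by (simp add: cis_cnj)
    ultimately have "0 < Re (cis (pi / 3) * (Q z * K z))"
      using w.Re_rotated_two_minus_K_divide_Q by (metis cnj.sel(1))
    moreover have "G z = cnj (- (Ln w / Q w))"
      unfolding zw G_cnj[OF pos] G_eq_Ln_Q[OF pos] Q_inverse[OF w.Re_z_pos] Ln by simp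
    then have "Im (G z) = Im (Ln w / Q w)" by (simp only: cnj.sel uminus_complex.sel minus_minus)
    ultimately show ?thesis
      using w.Im_Ln_divide_Q_pos by metis
  qed
  then show "0 < Re (cis (pi / 3) * (Q z * K z))" "0 < Arg z \<Longrightarrow> 0 < Im (G z)"
    by auto
qed

section \<open>Injectivity on the upper half and on the whole sector\<close>

lemma inj_on_G_upper_sector: "inj_on G upper_sector"
proof (rule inj_onI, rule ccontr)
  fix z1 z2 assume z: "z1 \<in> upper_sector" "z2 \<in> upper_sector" "G z1 = G z2" "z1 \<noteq> z2"
  define S where "S = {\<zeta>. Im \<zeta> \<ge> 0} \<inter> {\<zeta>. Im \<zeta> < pi / 3}"
  have nz: "z1 \<noteq> 0" "z2 \<noteq> 0" using z by (auto simp: upper_sector_def)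
  have "Ln z1 \<in> S" "Ln z2 \<in> S"
    using z nz by (auto simp: S_def upper_sector_def Arg_eq_Im_Ln)
  moreover have "convex S"
    unfolding S_def by (intro convex_Int convex_halfspace_Im_ge convex_halfspace_Im_lt)
  ultimately have seg: "closed_segment (Ln z1) (Ln z2) \<subseteq> S"
    by (simp add: closed_segment_subset)
  define d where "d = Ln z2 - Ln z1"
  have d: "d \<noteq> 0" using z(4) nz by (metis d_def exp_Ln right_minus_eq)
  \<comment> \<open>Dividing by \<open>d\<close> cancels the increment in the mean value theorem,
    leaving exactly the rotated derivative.\<close>
  define f where "f \<zeta> = cis (pi / 3) * G (exp \<zeta>) / d" for \<zeta>
  define f' where "f' \<zeta> = cis (pi / 3) * (Q (exp \<zeta>) * K (exp \<zeta>)) / d" for \<zeta>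
  have mem: "exp \<zeta> \<in> upper_sector" if "\<zeta> \<in> S" for \<zeta>
  proof -
    have "- pi < Im \<zeta>" "Im \<zeta> \<le> pi" using that pi_gt_zero by (auto simp: S_def intro: less_le_trans)
    then have "Arg (exp \<zeta>) = Im \<zeta>" by (simp add: Arg_eq_Im_Ln)
    then show ?thesis using that by (simp add: upper_sector_def S_def)
  qed
  have "(f has_field_derivative f' \<zeta>) (at \<zeta>)" if "\<zeta> \<in> closed_segment (Ln z1) (Ln z2)" for \<zeta>
  proof -
    have "exp \<zeta> \<in> upper_sector" using mem seg that by blast
    then have "0 < Re (exp \<zeta>)" by (intro Re_pos_if_Arg) (auto simp: upper_sector_def)
    from DERIV_chain2[OF G_has_field_derivative[OF this] DERIV_exp]
    have "((\<lambda>\<zeta>. G (exp \<zeta>)) has_field_derivative Q (exp \<zeta>) * K (exp \<zeta>)) (at \<zeta>)"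
      by simp
    then show ?thesis
      unfolding f_def f'_def by (intro DERIV_cdivide DERIV_cmult)
  qed
  from complex_mvt_line[OF this] obtain \<zeta> where
    \<zeta>: "\<zeta> \<in> closed_segment (Ln z1) (Ln z2)" "Re (f (Ln z2)) - Re (f (Ln z1)) = Re (f' \<zeta> * d)"
    unfolding d_def by blast
  have "f (Ln z1) = f (Ln z2)" using z(3) nz by (simp add: f_def)
  then have "Re (cis (pi / 3) * (Q (exp \<zeta>) * K (exp \<zeta>))) = 0"
    using \<zeta>(2) d by (simp add: f'_def)
  moreover have "0 < Re (cis (pi / 3) * (Q (exp \<zeta>) * K (exp \<zeta>)))"
    using mem seg \<zeta>(1) by (intro Re_rotated_log_deriv_pos) blast
  ultimately show False by simp
qed

theorem proposition1p5:
  "G holomorphic_on open_sector (- pi / 3) (pi / 3) \<and> inj_on G (open_sector (- pi / 3) (pi / 3))"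
proof
  let ?S = "open_sector (- pi / 3) (pi / 3)"
  have Re_pos: "0 < Re z" if "z \<in> ?S" for z
    using that by (intro Re_pos_if_Arg) (auto simp: open_sector_def)
  show "G holomorphic_on ?S"
  proof (rule holomorphic_onI)
    fix z assume "z \<in> ?S"
    then have "G field_differentiable at z"
      using G_has_field_derivative[OF Re_pos] by (meson field_differentiable_def)
    then show "G field_differentiable at z within ?S"
      by (rule field_differentiable_at_within)
  qed
  have upper: "z \<in> upper_sector" if "z \<in> ?S" "0 \<le> Arg z" for z
    using that by (auto simp: open_sector_def upper_sector_def)
  have lower: "cnj z \<in> upper_sector" "0 < Arg (cnj z)" if "z \<in> ?S" "Arg z < 0" for z
  proof -
    \<comment> \<open>Conjugation negates the argument only off the negative real axis; real points
      of the sector have argument 0, which Arg z < 0 excludes.\<close>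
    have "Arg (cnj z) = - Arg z"
      using that(2) Arg_eq_0[of z] Re_pos[OF that(1)] by (auto simp: Arg_cnj complex_is_Real_iff)
    then show "cnj z \<in> upper_sector" "0 < Arg (cnj z)"
      using that by (auto simp: open_sector_def upper_sector_def)
  qed
  have Im_nonneg: "0 \<le> Im (G z)" if "z \<in> ?S" "0 \<le> Arg z" for z
  proof (cases "Arg z = 0")
    case True
    then have "cnj z = z" by (simp add: Arg_eq_0 complex_is_Real_iff complex_eq_iff)
    then have "Im (G z) = - Im (G z)"
      using G_cnj[OF Re_pos[OF that(1)]] by (metis cnj.sel(2))
    then show ?thesis by simp
  next
    case False
    then show ?thesis using Im_G_pos[OF upper[OF that]] that by simp
  qed
  have Im_neg: "Im (G z) < 0" if "z \<in> ?S" "Arg z < 0" for z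
    using Im_G_pos[OF lower[OF that]] G_cnj[OF Re_pos[OF that(1)]] by simp
  show "inj_on G ?S"
  proof (rule inj_onI)
    fix z1 z2 assume z: "z1 \<in> ?S" "z2 \<in> ?S" "G z1 = G z2"
    \<comment> \<open>Mixed cases cannot occur: the imaginary part of G is nonnegative for Arg z >=
      0 and negative for Arg z < 0.\<close>
    consider "0 \<le> Arg z1" "0 \<le> Arg z2" | "Arg z1 < 0" "Arg z2 < 0"
      using z Im_nonneg Im_neg by (metis not_le)
    then show "z1 = z2"
    proof cases
      case 1
      then show ?thesis using inj_on_G_upper_sector z upper by (auto dest: inj_onD)
    next
      case 2
      have "G (cnj z1) = G (cnj z2)"
        using z G_cnj[OF Re_pos] by simp
      then have "cnj z1 = cnj z2"
        using inj_on_G_upper_sector z 2 lower by (auto dest: inj_onD)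
      then show ?thesis by simp
    qed
  qed
qed

end
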